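(* Let $f:\mathbb{N}\rightarrow\mathbb{R}$ be a non-decreasing function with $\lim_{n\to\infty}f(n)=+\infty$. Then there is a Sturmian word $\boldsymbol{u}$ such that $\mathrm{PL}_{\boldsymbol{u}}(n)=o(f(n))$ as $n\to\infty$.
   Context: A palindrome is a finite word equal to its reversal. The palindromic length $|v|_{\text{pal}}$ of a finite word $v$ is the minimal number $K$ of palindromes $p_1,\dots,p_K$ such that $v=p_1p_2\cdots p_K$. A Sturmian word is an infinite word over a binary alphabet having exactly $n+1$ distinct factors of length $n$ for every $n\geq 0$. For an infinite word $\boldsymbol{u}$, $\mathrm{PL}_{\boldsymbol{u}}:\mathbb{N}\to\mathbb{N}$ is defined by $\mathrm{PL}_{\boldsymbol{u}}(n)=\max\{|v|_{\text{pal}} : v \text{ is a factor of length } n \text{ of } \boldsymbol{u}\}$. *)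

theory Defs
  imports Complex_Main "HOL-Library.Landau_Symbols"
begin

definition palindrome :: "'a list \<Rightarrow> bool" where
  "palindrome w \<longleftrightarrow> rev w = w"

(* Empty palindromes are harmless in a minimal factorization; the empty word gets length 0. *)
definition pal_length :: "'a list \<Rightarrow> nat" where
  "pal_length v = (LEAST K. \<exists>ps. length ps = K \<and> (\<forall>p\<in>set ps. palindrome p) \<and> v = concat ps)"

definition factors :: "(nat \<Rightarrow> 'a) \<Rightarrow> nat \<Rightarrow> 'a list set" where
  "factors u n = {map u [i..<i + n] | i. True}"

definition sturmian :: "(nat \<Rightarrow> bool) \<Rightarrow> bool" where
  "sturmian u \<longleftrightarrow> (\<forall>n. card (factors u n) = n + 1)"

definition PL :: "(nat \<Rightarrow> 'a::finite) \<Rightarrow> nat \<Rightarrow> nat" where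
  "PL u n = Max (pal_length ` factors u n)"

lemma pal_factorization_exists:
  "\<exists>ps. length ps = length v \<and> (\<forall>p\<in>set ps. palindrome p) \<and> v = concat ps"
  by (rule exI[of _ "map (\<lambda>x. [x]) v"]) (auto simp: palindrome_def)

lemma finite_factors: "finite (factors (u :: nat \<Rightarrow> 'a::finite) n)"
  by (rule finite_subset[OF _ finite_lists_length_eq[of UNIV n]]) (auto simp: factors_def)

lemma factors_nonempty: "factors u n \<noteq> {}"
  by (auto simp: factors_def)

end

theory Submission
  imports Defs "HOL-Library.Sublist"
begin

text \<open>
  The witness is the limit of standard words
  \<open>s\<^sub>k\<^sub>+\<^sub>2 = s\<^sub>k\<^sub>+\<^sub>1\<^bsup>m\<^sub>k\<^esup> s\<^sub>k\<close> with rapidly growing exponents.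
  To each consecutive pair belongs a central palindrome \<open>c\<close> with
  \<open>|c| + 2 = |s\<^sub>k| + |s\<^sub>k\<^sub>+\<^sub>1|\<close> and \<open>X c = c (rev X)\<close> for \<open>X = s\<^sub>k, s\<^sub>k\<^sub>+\<^sub>1\<close>.
  Hence \<open>c\<close> is a prefix of everything that follows a block boundary, so there are at most
  \<open>|c| + 2\<close> factors of length \<open>|c| + 1\<close>; as \<open>s\<^sub>k\<close> and \<open>s\<^sub>k\<^sub>+\<^sub>1\<close> end in different letters,
  \<open>c\<close> is also right special. Since the complexity \<open>p\<close> is strictly increasing and \<open>p(n) \<le> n + 1\<close>
  for infinitely many \<open>n\<close>, the limit word is Sturmian.
  The same relation makes every power of \<open>s\<^sub>k\<close> a product of two palindromes, so the palindromic
  length of the factors of \<open>s\<^sub>k\<close> is bounded in terms of \<open>k\<close> alone, independently of the exponents.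
\<close>

subsection \<open>Palindromic length\<close>

lemma pal_length_le:
  assumes "\<forall>p\<in>set ps. palindrome p" "v = concat ps"
  shows "pal_length v \<le> length ps"
  unfolding pal_length_def using assms by (intro Least_le) blast

lemma pal_length_witness:
  obtains ps where "length ps = pal_length v" "\<forall>p\<in>set ps. palindrome p" "v = concat ps"
proof -
  have "\<exists>K ps. length ps = K \<and> (\<forall>p\<in>set ps. palindrome p) \<and> v = concat ps"
    using pal_factorization_exists[of v] by blast
  from LeastI_ex[OF this] show ?thesis
    using that unfolding pal_length_def by blast
qed

lemma pal_length_append: "pal_length (v @ w) \<le> pal_length v + pal_length w"
proof -
  obtain ps where ps: "length ps = pal_length v" "\<forall>p\<in>set ps. palindrome p" "v = concat ps"
    by (rule pal_length_witness)
  obtain qs where qs: "length qs = pal_length w" "\<forall>p\<in>set qs. palindrome p" "w = concat qs"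
    by (rule pal_length_witness)
  show ?thesis using pal_length_le[of "ps @ qs" "v @ w"] ps qs by auto
qed

lemma pal_length_Nil [simp]: "pal_length [] = 0"
  using pal_length_le[of "[]" "[]"] by simp

lemma pal_length_le_length: "pal_length v \<le> length v"
  using pal_factorization_exists[of v] pal_length_le by metis

text \<open>The relation \<open>W c = c (rev W)\<close> says that \<open>W = x y\<close> and \<open>c = (x y)\<^sup>i x\<close> with palindromes
  \<open>x\<close> and \<open>y\<close>; the induction strips copies of \<open>W\<close> off \<open>c\<close>.\<close>

lemma pal_length_le_2:
  assumes "rev c = c" "W @ c = c @ rev W"
  shows "pal_length W \<le> 2"
  using assms
proof (induction "length c" arbitrary: c rule: less_induct)
  case less
  show ?case
  proof (cases "length c < length W")
    case True
    from less.prems(2) True obtain y where y: "W = c @ y"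
      by (auto simp: append_eq_append_conv2)
    with less.prems have "palindrome y" by (simp add: palindrome_def)
    moreover have "palindrome c" using less.prems by (simp add: palindrome_def)
    ultimately show ?thesis using pal_length_le[of "[c, y]" W] y by simp
  next
    case False
    with less.prems(2) obtain d where d: "c = W @ d"
      by (auto simp: append_eq_append_conv2)
    with less.prems(2) have *: "W @ d = d @ rev W" by simp
    have "rev d @ rev W = d @ rev W" using less.prems(1) d * by (metis rev_append)
    hence "rev d = d" by simp
    show ?thesis
    proof (cases "W = []")
      case True
      then show ?thesis by simp
    next
      case False
      then show ?thesis using less.hyps[of d] d * \<open>rev d = d\<close> by simp
    qed
  qed
qed

subsection \<open>Factors of concatenations\<close>

lemma prefix_concatE:
  assumes "prefix v (concat ws)" "ws \<noteq> []"
  obtains mid p Y where "v = concat mid @ p" "prefix mid ws" "Y \<in> set ws" "prefix p Y"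
  using assms
proof (induction ws arbitrary: v thesis)
  case Nil
  then show ?case by simp
next
  case (Cons X ws)
  show ?case
  proof (cases "prefix v X")
    case True
    then show ?thesis using Cons.prems(1)[of "[]" v X] by simp
  next
    case False
    with Cons.prems(2) obtain v' where v': "v = X @ v'" "prefix v' (concat ws)"
      by (auto simp: prefix_append)
    show ?thesis
    proof (cases "ws = []")
      case True
      then show ?thesis using v' False by simp
    next
      case False
      obtain mid p Y where "v' = concat mid @ p" "prefix mid ws" "Y \<in> set ws" "prefix p Y"
        using Cons.IH[OF _ v'(2) False] by blast
      then show ?thesis using Cons.prems(1)[of "X # mid" p Y] v' by simp
    qed
  qed
qed

text \<open>A factor crossing a block boundary is cut at the first and last boundaries it meets.
  Keeping \<open>mid\<close> contiguous in \<open>ws\<close> lets a run of equal blocks be treated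
  as one power.\<close>

lemma sublist_concat_cases:
  assumes "sublist v (concat ws)" "v \<noteq> []"
  shows "(\<exists>X\<in>set ws. sublist v X) \<or>
    (\<exists>X\<in>set ws. \<exists>Y\<in>set ws. \<exists>s mid p.
      suffix s X \<and> sublist mid ws \<and> prefix p Y \<and> v = s @ concat mid @ p)"
  using assms(1)
proof (induction ws)
  case Nil
  then show ?case using assms(2) by simp
next
  case (Cons X ws)
  from Cons.prems consider "sublist v X" | "sublist v (concat ws)"
    | v1 v2 where "v = v1 @ v2" "suffix v1 X" "prefix v2 (concat ws)"
    by (auto simp: sublist_append)
  then show ?case
  proof cases
    case 1
    then show ?thesis by auto
  next
    case 2
    have "sublist mid (X # ws)" if "sublist mid ws" for mid
      using that by (simp add: sublist_Cons_right)
    then show ?thesis using Cons.IH[OF 2] by (meson list.set_intros(2))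
  next
    case 3
    show ?thesis
    proof (cases "ws = []")
      case True
      then show ?thesis using 3 by auto
    next
      case False
      from 3(3) False obtain mid p Y
        where *: "v2 = concat mid @ p" "prefix mid ws" "Y \<in> set ws" "prefix p Y"
        by (rule prefix_concatE)
      have "sublist mid (X # ws)"
        using *(2) by (simp add: sublist_Cons_right prefix_imp_sublist)
      moreover have "v = v1 @ concat mid @ p" using 3 * by simp
      ultimately have "suffix v1 X \<and> sublist mid (X # ws) \<and> prefix p Y \<and> v = v1 @ concat mid @ p"
        using 3(2) *(4) by blast
      then show ?thesis using *(3) by (intro disjI2 bexI[of _ X] bexI[of _ Y]) auto
    qed
  qed
qed

text \<open>Locates a starting position by its block and its offset there; such pairs are counted
  later to bound the complexity.\<close>

lemma drop_concatE:
  assumes "i < length (concat ws)"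
  obtains X t rest where "X \<in> set ws" "t < length X" "set rest \<subseteq> set ws"
    "drop i (concat ws) = drop t X @ concat rest"
  using assms
proof (induction ws arbitrary: i thesis)
  case Nil
  then show ?case by simp
next
  case (Cons X ws)
  show ?case
  proof (cases "i < length X")
    case True
    then show ?thesis using Cons.prems(1)[of X i ws] by auto
  next
    case False
    then have "i - length X < length (concat ws)" using Cons.prems(2) by simp
    from Cons.IH[OF _ this] obtain Y t rest where "Y \<in> set ws" "t < length Y"
      "set rest \<subseteq> set ws" "drop (i - length X) (concat ws) = drop t Y @ concat rest"
      by blast
    then show ?thesis using Cons.prems(1)[of Y t rest] False by auto
  qed
qed

subsection \<open>Standard words and central words\<close>

fun standard_word :: "(nat \<Rightarrow> nat) \<Rightarrow> nat \<Rightarrow> bool list" where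
  "standard_word m 0 = [True]"
| "standard_word m (Suc 0) = [False]"
| "standard_word m (Suc (Suc k)) =
    concat (replicate (m k) (standard_word m (Suc k))) @ standard_word m k"

text \<open>This is \<open>standard_word m (Suc k) @ standard_word m k\<close> without its last two
  letters, written as a recursion.\<close>

fun central_word :: "(nat \<Rightarrow> nat) \<Rightarrow> nat \<Rightarrow> bool list" where
  "central_word m 0 = []"
| "central_word m (Suc k) =
    concat (replicate (m k) (standard_word m (Suc k))) @ central_word m k"

lemma append_concat_replicate_commute:
  "X @ concat (replicate n X) = concat (replicate n X) @ X"
  by (induction n) auto

lemma concat_replicate_commute_rev:
  assumes "X @ c = c @ rev X"
  shows "concat (replicate n X) @ c = c @ rev (concat (replicate n X))"
proof (induction n)
  case (Suc n)
  have "concat (replicate (Suc n) X) = concat (replicate n X) @ X"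
    by (simp add: append_concat_replicate_commute)
  then have "rev (concat (replicate (Suc n) X)) = rev X @ rev (concat (replicate n X))"
    by simp
  then show ?case using Suc assms by (metis append.assoc concat.simps(2) replicate_Suc)
qed simp

text \<open>For fixed \<open>c\<close>, the relation \<open>X c = c (rev X)\<close> is stable under
  products of such \<open>X\<close>. It therefore passes to the power \<open>P\<close>, and makes
  the next central word \<open>P c\<close> a palindrome.\<close>

lemma central_word_palindromic:
  "rev (central_word m k) = central_word m k \<and>
   standard_word m k @ central_word m k = central_word m k @ rev (standard_word m k) \<and>
   standard_word m (Suc k) @ central_word m k = central_word m k @ rev (standard_word m (Suc k))"
proof (induction k)
  case 0
  then show ?case by simp
next
  case (Suc k)
  define A B c P where defs: "A = standard_word m (Suc k)" "B = standard_word m k"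
    "c = central_word m k" "P = concat (replicate (m k) A)"
  have c: "rev c = c" and B: "B @ c = c @ rev B" and A: "A @ c = c @ rev A"
    using Suc defs by auto
  have P: "P @ c = c @ rev P" using concat_replicate_commute_rev[OF A] defs by simp
  have AP: "A @ P = P @ A" unfolding defs
    by (rule append_concat_replicate_commute)
  have 1: "rev (P @ c) = P @ c" using P c by simp
  have 2: "A @ P @ c = (P @ c) @ rev A" using AP A by (metis append.assoc)
  \<comment> \<open>Move \<open>c\<close> leftwards:
    \<open>P B P c = P B c (rev P) = P c (rev B) (rev P)\<close>.\<close>
  have 3: "(P @ B) @ P @ c = (P @ c) @ rev (P @ B)" using P B by (metis append.assoc rev_append)
  show ?case using 1 2 3 by (simp add: defs)
qed

lemma standard_word_nonempty [simp]: "standard_word m k \<noteq> []"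
  by (induction m k rule: standard_word.induct) auto

lemma length_central_word:
  "length (central_word m k) + 2 = length (standard_word m k) + length (standard_word m (Suc k))"
  by (induction k) auto

text \<open>Each standard word ends in the one two steps earlier, so the last letters
  alternate.\<close>

lemma last_standard_word_neq: "last (standard_word m k) \<noteq> last (standard_word m (Suc k))"
  by (induction k) auto

text \<open>Each block \<open>X\<close> satisfies \<open>X c = c (rev X)\<close>, so
  \<open>c\<close> survives as a prefix when blocks are prepended. The trailing \<open>c\<close>
  covers concatenations shorter than \<open>c\<close>.\<close>

lemma central_word_prefix_concat:
  assumes "set ws \<subseteq> {standard_word m k, standard_word m (Suc k)}"
  shows "prefix (central_word m k) (concat ws @ central_word m k)"
  using assms
proof (induction ws)
  case (Cons X ws)
  let ?c = "central_word m k"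
  have "X @ ?c = ?c @ rev X" using Cons.prems central_word_palindromic[of m k] by auto
  then have "prefix ?c (X @ ?c)" by simp
  also have "prefix (X @ ?c) (X @ concat ws @ ?c)" using Cons by simp
  finally show ?case by simp
qed simp

lemma standard_word_blocks:
  "k \<le> i \<Longrightarrow> \<exists>ws. set ws \<subseteq> {standard_word m k, standard_word m (Suc k)} \<and>
    standard_word m i = concat ws"
proof (induction i rule: less_induct)
  case (less i)
  consider "i = k" | "i = Suc k" | j where "i = Suc (Suc j)" "k \<le> j"
    using less.prems by (cases i rule: nat.exhaust; cases "i - 1") (auto simp: le_Suc_eq)
  then show ?case
  proof cases
    case 1
    then show ?thesis by (intro exI[of _ "[standard_word m k]"]) simp
  next
    case 2
    then show ?thesis by (intro exI[of _ "[standard_word m (Suc k)]"]) simp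
  next
    case 3
    obtain vs where vs: "set vs \<subseteq> {standard_word m k, standard_word m (Suc k)}"
      "standard_word m (Suc j) = concat vs" using less.IH[of "Suc j"] 3 by auto
    obtain ws where ws: "set ws \<subseteq> {standard_word m k, standard_word m (Suc k)}"
      "standard_word m j = concat ws" using less.IH[of j] 3 by auto
    have "concat (concat (replicate n vs)) = concat (replicate n (concat vs))" for n
      by (induction n) auto
    then show ?thesis using 3 vs ws
      by (intro exI[of _ "concat (replicate (m j) vs) @ ws"]) auto
  qed
qed

lemma pal_length_concat_replicate_standard_word:
  "pal_length (concat (replicate n (standard_word m k))) \<le> 2"
  using pal_length_le_2[of "central_word m k"] central_word_palindromic[of m k]
    concat_replicate_commute_rev by blast

lemma pal_length_standard_word: "pal_length (standard_word m k) \<le> 2"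
  using pal_length_concat_replicate_standard_word[of 1 m k] by simp

text \<open>A factor of \<open>A ... A B\<close> splits into two partial blocks, each costing at
  most \<open>5 * 5 ^ j\<close>, and a middle of complete blocks costing at most 4 whatever the
  exponent.\<close>

lemma pal_length_sublist_standard_word:
  "sublist v (standard_word m k) \<Longrightarrow> pal_length v \<le> 5 ^ k"
proof (induction k arbitrary: v rule: less_induct)
  case (less k)
  consider "k = 0" | "k = Suc 0" | j where "k = Suc (Suc j)"
    by (metis not0_implies_Suc)
  then show ?case
  proof cases
    case 1
    then show ?thesis using less.prems sublist_length_le[of v "standard_word m k"]
        pal_length_le_length[of v] by simp
  next
    case 2
    then show ?thesis using less.prems sublist_length_le[of v "standard_word m k"]
        pal_length_le_length[of v] by simp
  next
    case 3
    define A B where AB: "A = standard_word m (Suc j)" "B = standard_word m j"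
    define ws where "ws = replicate (m j) A @ [B]"
    have A: "pal_length x \<le> 5 * 5 ^ j" if "sublist x A" for x
      using less.IH[of "Suc j" x] 3 that AB by simp
    have B: "pal_length x \<le> 5 * 5 ^ j" if "sublist x B" for x
      using less.IH[of j x] 3 that AB by (simp add: le_trans)
    have ws: "pal_length x \<le> 5 * 5 ^ j" if "X \<in> set ws" "sublist x X" for x X
      using that A B by (auto simp: ws_def)
    show ?thesis
    proof (cases "v = []")
      case False
      have "sublist v (concat ws)" using less.prems 3 AB by (simp add: ws_def)
      from sublist_concat_cases[OF this False] show ?thesis
      proof
        assume "\<exists>X\<in>set ws. sublist v X"
        then show ?thesis using ws 3 by fastforce
      next
        assume "\<exists>X\<in>set ws. \<exists>Y\<in>set ws. \<exists>s mid p.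
          suffix s X \<and> sublist mid ws \<and> prefix p Y \<and> v = s @ concat mid @ p"
        then obtain X Y s mid p where *: "X \<in> set ws" "Y \<in> set ws" "suffix s X"
          "sublist mid ws" "prefix p Y" "v = s @ concat mid @ p" by blast
        have rep: "x = replicate (length x) A" if "sublist x (replicate (m j) A)" for x
          using set_mono_sublist[OF that] by (auto intro!: replicate_eqI)
        \<comment> \<open>\<open>B\<close> occurs only at the end of \<open>ws\<close>, so the
          middle is a power of \<open>A\<close> followed by at most one \<open>B\<close>.\<close>
        from *(4) consider "sublist mid (replicate (m j) A)" | "sublist mid [B]"
          | m1 m2 where "mid = m1 @ m2" "suffix m1 (replicate (m j) A)" "prefix m2 [B]"
          unfolding ws_def by (auto simp: sublist_append)
        then obtain i m2 where mid: "mid = replicate i A @ m2" "m2 = [] \<or> m2 = [B]"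
        proof cases
          case 1
          then show ?thesis using that[of _ "[]"] rep by auto
        next
          case 2
          then show ?thesis using that[of 0 mid] by (auto simp: sublist_Cons_right prefix_Cons)
        next
          case 3
          then show ?thesis using that[of "length m1" m2] rep[of m1] by (auto simp: prefix_Cons)
        qed
        have "pal_length (concat (replicate i A)) \<le> 2" "pal_length B \<le> 2"
          using AB pal_length_concat_replicate_standard_word pal_length_standard_word by auto
        then have "pal_length (concat mid) \<le> 4"
          using mid pal_length_append[of "concat (replicate i A)" B] by auto
        moreover have "pal_length s \<le> 5 * 5 ^ j" "pal_length p \<le> 5 * 5 ^ j"
          using ws * by auto
        moreover have "pal_length v \<le> pal_length s + (pal_length (concat mid) + pal_length p)"
          using *(6) pal_length_append[of s "concat mid @ p"]
            pal_length_append[of "concat mid" p] by simp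
        moreover have "(1::nat) \<le> 5 ^ j" by simp
        moreover have "(5::nat) ^ k = 25 * 5 ^ j" using 3 by simp
        ultimately show ?thesis by linarith
      qed
    qed simp
  qed
qed

subsection \<open>The limit word\<close>

locale characteristic_word =
  fixes m :: "nat \<Rightarrow> nat"
  assumes m_pos: "m k > 0"
begin

abbreviation s :: "nat \<Rightarrow> bool list" where "s \<equiv> standard_word m"
abbreviation c :: "nat \<Rightarrow> bool list" where "c \<equiv> central_word m"

text \<open>The index is in range because \<open>s (Suc n)\<close> is longer than \<open>n\<close>.
  The prefix chain starts at \<open>s 1\<close>, since \<open>s 0\<close> is the other
  letter.\<close>

definition u :: "nat \<Rightarrow> bool" where "u n = s (Suc n) ! n"

lemma s_Suc_Suc: obtains w where "s (Suc (Suc k)) = s (Suc k) @ w @ s k"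
  using m_pos[of k] by (cases "m k") auto

lemma length_s_less: "length (s (Suc k)) < length (s (Suc (Suc k)))"
  by (rule s_Suc_Suc[of k]) (simp del: standard_word.simps)

lemma length_s_gt: "k < length (s (Suc k))"
proof (induction k)
  case (Suc k)
  then show ?case using length_s_less[of k] by linarith
qed simp

lemma length_s_mono: "i \<le> j \<Longrightarrow> length (s (Suc i)) \<le> length (s (Suc j))"
  by (rule lift_Suc_mono_le[of "\<lambda>i. length (s (Suc i))"]) (rule less_imp_le[OF length_s_less])

lemma prefix_s: "i \<le> j \<Longrightarrow> prefix (s (Suc i)) (s (Suc j))"
proof (induction rule: dec_induct)
  case (step j)
  have "prefix (s (Suc j)) (s (Suc (Suc j)))"
    by (rule s_Suc_Suc[of j]) (simp del: standard_word.simps)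
  then show ?case using step.IH by (meson prefix_order.trans)
qed simp

lemma u_eq_nth: "n < length (s (Suc k)) \<Longrightarrow> u n = s (Suc k) ! n"
proof -
  assume n: "n < length (s (Suc k))"
  have "s (Suc i) ! n = s (Suc j) ! n" if "i \<le> j" "n < length (s (Suc i))" for i j
    using prefix_s[OF that(1)] that(2) by (auto simp: prefix_def nth_append simp del: standard_word.simps)
  then show ?thesis unfolding u_def using n length_s_gt[of n] by (metis nle_le)
qed

text \<open>Reduces questions about \<open>u\<close> to finite words, where block decompositions are
  available.\<close>

lemma in_factors_iff: "w \<in> factors u n \<longleftrightarrow> length w = n \<and> (\<exists>k. sublist w (s (Suc k)))"
proof
  assume "w \<in> factors u n"
  then obtain i where i: "w = map u [i..<i + n]" by (auto simp: factors_def)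
  have "i + n < length (s (Suc (i + n)))" by (rule length_s_gt)
  then have "w = take n (drop i (s (Suc (i + n))))"
    unfolding i by (intro nth_equalityI) (auto simp: u_eq_nth simp del: standard_word.simps)
  then show "length w = n \<and> (\<exists>k. sublist w (s (Suc k)))"
    using i by (metis length_map length_upt add_diff_cancel_left' sublist_take sublist_drop sublist_order.order.trans)
next
  assume "length w = n \<and> (\<exists>k. sublist w (s (Suc k)))"
  then obtain k x y where w: "length w = n" "s (Suc k) = x @ w @ y"
    by (auto simp: sublist_def)
  have "w = map u [length x..<length x + n]"
  proof (intro nth_equalityI)
    fix i assume i: "i < length w"
    then have "u (length x + i) = s (Suc k) ! (length x + i)"
      using w by (intro u_eq_nth) simp
    then show "w ! i = map u [length x..<length x + n] ! i"
      using i w by (simp add: nth_append)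
  qed (use w in simp)
  then show "w \<in> factors u n" by (auto simp: factors_def)
qed

section \<open>Factor complexity of the limit word\<close>

text \<open>The starting block and the offset in it determine the factor, because \<open>c k\<close>
  follows the block. There are \<open>length (s k) + length (s (Suc k))\<close> such pairs.\<close>

lemma card_factors_le: "card (factors u (length (c k) + 1)) \<le> length (c k) + 2"
proof -
  let ?n = "length (c k) + 1"
  let ?f = "\<lambda>X t. take ?n (drop t X @ c k)"
  let ?S = "?f (s k) ` {..<length (s k)} \<union> ?f (s (Suc k)) ` {..<length (s (Suc k))}"
  have "factors u ?n \<subseteq> ?S"
  proof
    fix w assume "w \<in> factors u ?n"
    then obtain j where j: "length w = ?n" "sublist w (s (Suc j))"
      by (auto simp: in_factors_iff)
    have "sublist w (s (Suc (max k j)))"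
      using j prefix_s[of j "max k j"] by (meson max.cobounded2 prefix_imp_sublist sublist_order.order.trans)
    moreover obtain ws where ws: "set ws \<subseteq> {s k, s (Suc k)}" "s (Suc (max k j)) = concat ws"
      using standard_word_blocks[of k "Suc (max k j)" m] by (metis le_SucI max.cobounded1)
    ultimately obtain x y where xy: "concat ws = x @ w @ y" by (auto simp: sublist_def)
    have "length x < length (concat ws)" using xy j by simp
    then obtain X t rest where X: "X \<in> set ws" "t < length X" "set rest \<subseteq> set ws"
      "drop (length x) (concat ws) = drop t X @ concat rest" by (rule drop_concatE)
    have "prefix (c k) (concat rest @ c k)"
      using central_word_prefix_concat[of rest m k] X ws by blast
    then obtain z where z: "concat rest @ c k = c k @ z" by (auto simp: prefix_def)
    have "w @ y = drop t X @ concat rest" using X(4) xy by simp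
    then have "w @ y @ c k = drop t X @ c k @ z" using z by (metis append.assoc)
    then have "take ?n (w @ y @ c k) = take ?n (drop t X @ c k @ z)" by simp
    moreover have "take ?n (w @ y @ c k) = w" using j by simp
    \<comment> \<open>As \<open>t < length X\<close>, at least one letter precedes
      \<open>c k\<close>; this is the extra 1 in \<open>?n\<close>, so \<open>z\<close> is never
      reached.\<close>
    moreover have "take ?n (drop t X @ c k @ z) = ?f X t" using X(2) by simp
    ultimately have "w = ?f X t" by simp
    moreover have "X = s k \<or> X = s (Suc k)" using X(1) ws by blast
    ultimately show "w \<in> ?S" using X(2) by blast
  qed
  then have "card (factors u ?n) \<le> card ?S" by (intro card_mono) auto
  also have "\<dots> \<le> card (?f (s k) ` {..<length (s k)}) + card (?f (s (Suc k)) ` {..<length (s (Suc k))})"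
    by (rule card_Un_le)
  also have "\<dots> \<le> length (s k) + length (s (Suc k))"
    by (intro add_mono; rule order.trans[OF card_image_le]; simp)
  also have "\<dots> = length (c k) + 2" by (simp only: length_central_word)
  finally show ?thesis .
qed

lemma central_word_prefix_s: "\<exists>j. prefix (c k) (s (Suc j))"
proof -
  define j where "j = max k (length (c k))"
  obtain ws where ws: "set ws \<subseteq> {s k, s (Suc k)}" "s (Suc j) = concat ws"
    using standard_word_blocks[of k "Suc j" m] unfolding j_def
    by (metis le_SucI max.cobounded1)
  have "prefix (c k) (s (Suc j) @ c k)" using central_word_prefix_concat ws by simp
  moreover have "length (c k) \<le> length (s (Suc j))"
    using length_s_gt[of j] unfolding j_def by linarith
  ultimately have "prefix (c k) (s (Suc j))" by (meson prefix_length_prefix prefix_def)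
  then show ?thesis ..
qed

text \<open>In \<open>c (Suc k)\<close> the last copy of \<open>s (Suc k)\<close> is followed by
  \<open>c k\<close>. For \<open>s k\<close>, which ends \<open>s (Suc (Suc k))\<close>, the
  following \<open>c (Suc k)\<close> begins with \<open>c k\<close>.\<close>

lemma s_central_factor:
  assumes "X = s k \<or> X = s (Suc k)"
  shows "\<exists>j. sublist (X @ c k) (s (Suc j))"
proof -
  have step: "sublist (s (Suc k) @ c k) (c (Suc k))" for k
  proof -
    obtain n where "m k = Suc n" using m_pos[of k] by (cases "m k") auto
    then have "c (Suc k) = concat (replicate n (s (Suc k))) @ s (Suc k) @ c k"
      by (simp add: append_concat_replicate_commute del: standard_word.simps)
    then show ?thesis by simp
  qed
  have "sublist (X @ c k) (c (Suc k)) \<or> sublist (X @ c k) (c (Suc (Suc k)))"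
  proof (cases "X = s (Suc k)")
    case True
    then show ?thesis using step by blast
  next
    case False
    then have X: "X = s k" using assms by blast
    have "prefix (c k) (c (Suc k))"
      using central_word_prefix_concat[of "replicate (m k) (s (Suc k))" m k]
      by (simp add: set_replicate_conv_if)
    then have "sublist (X @ c k) (s (Suc (Suc k)) @ c (Suc k))"
      unfolding X prefix_def sublist_def by (metis append.assoc standard_word.simps(3))
    then show ?thesis using step[of "Suc k"] by (meson sublist_order.order.trans)
  qed
  then show ?thesis using central_word_prefix_s by (meson prefix_imp_sublist sublist_order.order.trans)
qed

text \<open>By \<open>X c = c (rev X)\<close>, the word \<open>c\<close> is followed by the last
  letter of \<open>X\<close>, and the two choices of \<open>X\<close> end differently. Suffixes of
  \<open>c\<close> inherit both extensions, which reaches every length \<open>n\<close>.\<close>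

lemma right_special:
  obtains w x y where "length w = n" "x \<noteq> y"
    "w @ [x] \<in> factors u (Suc n)" "w @ [y] \<in> factors u (Suc n)"
proof -
  have len: "n \<le> length (c (Suc n))"
    using length_central_word[of m "Suc n"] length_s_gt[of n] length_s_gt[of "Suc n"] by linarith
  define w where "w = drop (length (c (Suc n)) - n) (c (Suc n))"
  have "w @ [last X] \<in> factors u (Suc n)" if X: "X = s (Suc n) \<or> X = s (Suc (Suc n))" for X
  proof -
    have "X \<noteq> []" using X standard_word_nonempty by metis
    then have "rev X = last X # rev (butlast X)"
      by (metis append_butlast_last_id rev.simps(2) rev_rev_ident rev_append rev_singleton_conv append_Cons append_Nil)
    moreover have "X @ c (Suc n) = c (Suc n) @ rev X"
      using X central_word_palindromic[of m "Suc n"] by blast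
    moreover have "suffix w (c (Suc n))" unfolding w_def by (rule suffix_drop)
    then obtain z where "c (Suc n) = z @ w" by (auto simp: suffix_def)
    ultimately have "X @ c (Suc n) = z @ (w @ [last X]) @ rev (butlast X)"
      by (metis append.assoc append_Cons append_Nil)
    then have "sublist (w @ [last X]) (X @ c (Suc n))" unfolding sublist_def by blast
    then have "\<exists>j. sublist (w @ [last X]) (s (Suc j))"
      using s_central_factor[OF X] by (meson sublist_order.order.trans)
    then show ?thesis using len by (simp add: in_factors_iff w_def del: central_word.simps standard_word.simps)
  qed
  then show ?thesis
    using that[of w "last (s (Suc n))" "last (s (Suc (Suc n)))"] len last_standard_word_neq
    by (simp add: w_def del: central_word.simps standard_word.simps)
qed

text \<open>Deleting the last letter reaches every shorter factor, and a right special factor is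
  reached twice.\<close>

lemma card_factors_less: "card (factors u n) < card (factors u (Suc n))"
proof -
  have "factors u n \<subseteq> butlast ` factors u (Suc n)"
  proof
    fix w assume "w \<in> factors u n"
    then obtain i where "w = map u [i..<i + n]" by (auto simp: factors_def)
    then have "w = butlast (map u [i..<i + Suc n])" by (simp add: map_butlast[symmetric])
    then show "w \<in> butlast ` factors u (Suc n)" unfolding factors_def by blast
  qed
  then have "card (factors u n) \<le> card (butlast ` factors u (Suc n))"
    by (intro card_mono finite_imageI finite_factors)
  moreover have "\<not> inj_on butlast (factors u (Suc n))"
    by (rule right_special[of n]) (auto simp: inj_on_def, metis butlast_snoc last_snoc)
  then have "card (butlast ` factors u (Suc n)) \<noteq> card (factors u (Suc n))"
    using eq_card_imp_inj_on[OF finite_factors] by blast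
  moreover have "card (butlast ` factors u (Suc n)) \<le> card (factors u (Suc n))"
    by (intro card_image_le finite_factors)
  ultimately show ?thesis by linarith
qed

lemma card_factors_add: "card (factors u n) + d \<le> card (factors u (n + d))"
proof (induction d)
  case (Suc d)
  then show ?case using card_factors_less[of "n + d"] by simp
qed simp

lemma sturmian_u: "sturmian u"
  unfolding sturmian_def
proof
  fix n
  have "factors u 0 = {[]}" by (auto simp: factors_def)
  then have "n + 1 \<le> card (factors u n)" using card_factors_add[of 0 n] by simp
  moreover have "card (factors u n) \<le> n + 1"
  proof -
    define N where "N = length (c (Suc n)) + 1"
    have "n \<le> N" using length_central_word[of m "Suc n"] length_s_gt[of n] length_s_gt[of "Suc n"]
      unfolding N_def by linarith
    moreover have "card (factors u N) \<le> N + 1" unfolding N_def using card_factors_le[of "Suc n"] by linarith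
    \<comment> \<open>Strict growth carries the bound down from \<open>N\<close> to
      \<open>n\<close>: an excess at \<open>n\<close> would persist at \<open>N\<close>.\<close>
    ultimately show ?thesis using card_factors_add[of n "N - n"] by simp
  qed
  ultimately show "card (factors u n) = n + 1" by simp
qed

section \<open>Palindromic length of factors of the limit word\<close>

text \<open>Over the blocks \<open>s (Suc k)\<close> and \<open>s (Suc (Suc k))\<close>, both longer
  than \<open>n\<close>, a factor crosses at most one boundary. It is thus at most two partial
  blocks, each costing at most \<open>5 ^ (k + 2)\<close>.\<close>

lemma PL_le:
  assumes "n < length (s (Suc k))"
  shows "PL u n \<le> 2 * 5 ^ (k + 2)"
proof -
  have "pal_length v \<le> 2 * 5 ^ (k + 2)" if "v \<in> factors u n" for v
  proof (cases "v = []")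
    case False
    from that obtain j where j: "length v = n" "sublist v (s (Suc j))"
      by (auto simp: in_factors_iff)
    have "sublist v (s (Suc (max k j)))"
      using j prefix_s[of j "max k j"] by (meson max.cobounded2 prefix_imp_sublist sublist_order.order.trans)
    moreover obtain ws where ws: "set ws \<subseteq> {s (Suc k), s (Suc (Suc k))}" "s (Suc (max k j)) = concat ws"
      using standard_word_blocks[of "Suc k" "Suc (max k j)" m] by (metis Suc_le_mono max.cobounded1)
    ultimately have sub: "sublist v (concat ws)" by simp
    have block: "pal_length x \<le> 5 ^ (k + 2)" if "X \<in> set ws" "sublist x X" for x X
    proof -
      have "X = s (Suc k) \<or> X = s (k + 2)" using ws that by auto
      moreover have "(5::nat) ^ Suc k \<le> 5 ^ (k + 2)" by simp
      ultimately show ?thesis using pal_length_sublist_standard_word that(2) le_trans by blast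
    qed
    from sublist_concat_cases[OF sub False] show ?thesis
    proof
      assume "\<exists>X\<in>set ws. sublist v X"
      then show ?thesis using block by fastforce
    next
      assume "\<exists>X\<in>set ws. \<exists>Y\<in>set ws. \<exists>s mid p.
          suffix s X \<and> sublist mid ws \<and> prefix p Y \<and> v = s @ concat mid @ p"
      then obtain X Y r mid p where *: "X \<in> set ws" "Y \<in> set ws" "suffix r X"
        "sublist mid ws" "prefix p Y" "v = r @ concat mid @ p" by blast
      have "mid = []"
      proof (rule ccontr)
        assume "mid \<noteq> []"
        then obtain Z mid' where Z: "mid = Z # mid'" by (cases mid) auto
        then have "Z \<in> {s (Suc k), s (Suc (Suc k))}" using set_mono_sublist[OF *(4)] ws(1) by auto
        then have "length (s (Suc k)) \<le> length Z" using length_s_less[of k] by fastforce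
        moreover have "length Z \<le> n" using j(1) *(6) Z by simp
        ultimately show False using assms by linarith
      qed
      then have "pal_length v \<le> pal_length r + pal_length p"
        using *(6) pal_length_append[of r p] by simp
      then show ?thesis using block[of X r] block[of Y p] * by simp
    qed
  qed simp
  then show ?thesis unfolding PL_def
    using finite_factors[of u n] factors_nonempty[of u n] by (subst Max_le_iff) auto
qed

end

section \<open>Choice of the exponents from \<open>f\<close>\<close>

theorem theorem3:
  fixes f :: "nat \<Rightarrow> real"
  assumes "mono f"
    and "filterlim f at_top sequentially"
  shows "\<exists>u :: nat \<Rightarrow> bool. sturmian u \<and> (\<lambda>n. real (PL u n)) \<in> o(f)"
proof -
  \<comment> \<open>The first factor is the bound of \<open>PL_le\<close> at level
    \<open>k + 1\<close>; the factor \<open>real k\<close> makes the quotient tend to 0.\<close>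
  define H where "H k = 2 * 5 ^ (k + 3) * real k" for k :: nat
  have "\<exists>N. \<forall>n\<ge>N. f n \<ge> H k" for k
    using assms(2) by (simp add: filterlim_at_top eventually_sequentially)
  then obtain t where t: "\<And>k n. t k \<le> n \<Longrightarrow> H k \<le> f n" by metis
  \<comment> \<open>This exponent makes \<open>s (Suc (Suc k))\<close> longer than the threshold
    \<open>t (Suc k)\<close>; \<open>Suc\<close> gives strictness and positivity.\<close>
  define m where "m k = Suc (t (Suc k))" for k
  interpret characteristic_word m by unfold_locales (simp add: m_def)
  have long: "t k < length (s (Suc k))" if "k \<ge> 1" for k
  proof -
    obtain j where j: "k = Suc j" using \<open>k \<ge> 1\<close> by (cases k) auto
    have "m j \<le> m j * length (s (Suc j))" by (simp add: Suc_le_eq)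
    also have "\<dots> \<le> length (s (Suc (Suc j)))"
      by (simp add: length_concat sum_list_replicate del: standard_word.simps(2))
    finally show ?thesis by (simp add: j m_def del: standard_word.simps)
  qed
  have "(\<lambda>n. real (PL u n)) \<in> o(f)"
  proof (rule landau_o.smallI)
    fix e :: real assume "e > 0"
    obtain K :: nat where K: "1 / e \<le> real K" using real_arch_simple by blast
    have "norm (real (PL u n)) \<le> e * norm (f n)" if n: "length (s (Suc (Suc K))) \<le> n" for n
    proof -
      \<comment> \<open>With \<open>k = Suc i\<close>, \<open>n\<close> lies between the lengths of
        \<open>s (Suc i)\<close> and \<open>s (Suc (Suc i))\<close>: the lower bound forces
        \<open>f n\<close> above \<open>H i\<close>, the upper one bounds
        \<open>PL u n\<close>.\<close>
      define k where "k = (LEAST k. n < length (s (Suc k)))"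
      have k: "n < length (s (Suc k))" unfolding k_def by (rule LeastI[of _ n]) (rule length_s_gt)
      have "Suc K < k"
      proof (rule ccontr)
        assume "\<not> Suc K < k"
        then show False using length_s_mono[of k "Suc K"] n k by linarith
      qed
      then obtain i where i: "k = Suc i" "K < i" by (cases k) auto
      have "\<not> n < length (s (Suc i))" using not_less_Least[of i "\<lambda>k. n < length (s (Suc k))"] i k_def by simp
      then have "H i \<le> f n" using long[of i] i by (intro t) linarith
      moreover have "real (PL u n) \<le> 2 * 5 ^ (i + 3)"
      proof -
        have "PL u n \<le> 2 * 5 ^ (i + 3)" using PL_le[OF k] i by (simp add: numeral_eq_Suc)
        then have "real (PL u n) \<le> real (2 * 5 ^ (i + 3))" by (rule of_nat_mono)
        then show ?thesis by simp
      qed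
      moreover have "2 * 5 ^ (i + 3) \<le> e * H i"
      proof -
        have "1 / e \<le> real i" using K i by linarith
        then have "1 \<le> e * real i" using \<open>e > 0\<close> by (simp add: field_simps)
        then have "2 * 5 ^ (i + 3) * 1 \<le> 2 * 5 ^ (i + 3) * (e * real i)"
          by (intro mult_left_mono) auto
        then show ?thesis by (simp add: H_def mult_ac)
      qed
      moreover have "e * H i \<le> e * norm (f n)"
        using \<open>H i \<le> f n\<close> \<open>e > 0\<close> by (intro mult_left_mono) auto
      ultimately show ?thesis by simp
    qed
    then show "\<forall>\<^sub>F n in sequentially. norm (real (PL u n)) \<le> e * norm (f n)"
      unfolding eventually_sequentially by blast
  qed
  then show ?thesis using sturmian_u by blast
qed

end
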